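(* Let $n\ge3$ be an integer. Let $\mathbf p:=(p_1,\ldots,p_n)\in\mathbb Z_{\ge2}^n$ be a vector of pairwise coprime integers with $k_{\mathbf p}=1$. Define $$\mathbf w:=\left(\frac{\prod_{i=1}^np_i}{p_1},\ldots,\frac{\prod_{i=1}^np_i}{p_n}\right)\in\mathbb Z_{\ge1}^n.$$ Then both of the following hold: (a) there exists a $\mathbf w$-bubble $\mathbf u$ with $\mathbf w\cdot\mathbf u=(n-1)d_{\mathbf w}+1$ for which there exists $i\in\{1,\ldots,n\}$ such that for all positive integers $m$, $$\mathbf u+\frac{\left((n-2)m-\left\lfloor\frac{\mathbf w\cdot\mathbf u}{d_{\mathbf w}}\right\rfloor\right)d_{\mathbf w}}{w_i}\,\mathbf e_i\notin mV_{\mathbf w}^+((n-2)d_{\mathbf w});$$ (b) every $\mathbf w$-bubble $\mathbf u'$ satisfies $\mathbf w\cdot\mathbf u'<nd_{\mathbf w}$.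
   Context: Definition of $k_{\mathbf p}$: for an integer $n\ge2$ and pairwise coprime integers $p_1,\ldots,p_n$ greater than $1$, there is a unique $\mathbf a\in\mathbb Z_{\ge0}^n$ with $a_i<p_i$ for all $i$ such that $\sum_{i=1}^n\frac{a_i}{p_i}+\prod_{i=1}^n\frac1{p_i}$ is an integer; this integer is denoted $k_{\mathbf p}$. Notation: $d_{\mathbf w}=\operatorname{lcm}(w_1,\ldots,w_n)$; $\mathbf a\cdot\mathbf b=\sum_ia_ib_i$; $\mathbf e_i$ is the $i$th unit vector; $\mathbf a\preceq\mathbf b$ means $a_i\le b_i$ for all $i$. For a positive integer $m$, $V^+_{\mathbf w}(m)=\{\mathbf v\in\mathbb Z_{\ge0}^n\mid\mathbf w\cdot\mathbf v\ge m\}$; for $S\subseteq\mathbb Z_{\ge0}^n$, $mS$ is the Minkowski sum $S+\ldots+S$ with $m$ summands. A $\mathbf w$-bubble is an element $\mathbf u\in\mathbb Z_{\ge0}^n$ such that $\mathbf w\cdot\mathbf u\ge2d_{\mathbf w}$ and there is no $\mathbf v\in\mathbb Z_{\ge0}^n$ with $\mathbf w\cdot\mathbf v=d_{\mathbf w}$ and $\mathbf v\preceq\mathbf u$. *)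

theory Defs
  imports "HOL-Analysis.Analysis" "HOL-Library.Set_Algebras"
begin

text \<open>
  Vectors indexed by \<open>{1..n}\<close> are elements of \<open>int ^ 'n\<close> with \<open>n = CARD('n)\<close>. Vectors with
  nonnegative entries are singled out by \<open>0 \<le> v\<close>, where \<open>\<le>\<close> is the componentwise order
  (\<open>less_eq_vec_def\<close>). The entries are integers rather than naturals because the vector
  \<open>u + (((n - 2) m - \<lfloor>w \<cdot> u / d\<rfloor>) d / w\<^sub>i) e\<^sub>i\<close> can have a negative entry, in which case
  it lies in no subset of the nonnegative orthant. The divisions by \<open>w\<^sub>i\<close> (a divisor of \<open>d\<close>) and
  \<open>p\<^sub>i\<close> (a divisor of the product) are exact, and integer \<open>div\<close> is the floor of the
  quotient, so \<open>div\<close> renders all three.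
\<close>

definition dot :: "int ^ 'n \<Rightarrow> int ^ 'n \<Rightarrow> int" where
  "dot a b = (\<Sum>i\<in>UNIV. a $ i * b $ i)"

definition lcm_vec :: "int ^ 'n \<Rightarrow> int" where
  "lcm_vec w = (LCM i. w $ i)"

definition Vplus :: "int ^ 'n \<Rightarrow> int \<Rightarrow> (int ^ 'n) set" where
  "Vplus w m = {v. 0 \<le> v \<and> m \<le> dot w v}"

text \<open>The sum uses the Minkowski addition of sets from \<^theory>\<open>HOL-Library.Set_Algebras\<close>.\<close>

definition minkowski_multiple :: "nat \<Rightarrow> (int ^ 'n) set \<Rightarrow> (int ^ 'n) set" where
  "minkowski_multiple m S = (\<Sum>j<m. S)"

definition bubble :: "int ^ 'n \<Rightarrow> int ^ 'n \<Rightarrow> bool" where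
  "bubble w u \<longleftrightarrow> 0 \<le> u \<and> 2 * lcm_vec w \<le> dot w u \<and>
    \<not> (\<exists>v. 0 \<le> v \<and> dot w v = lcm_vec w \<and> v \<le> u)"

text \<open>The vector \<open>a\<close> is unique by \<open>k_of_vector_ex1\<close> below, and it determines \<open>k\<close>.\<close>

definition k_of :: "int ^ 'n \<Rightarrow> int" where
  "k_of p = (THE k. \<exists>a. (\<forall>i. 0 \<le> a $ i \<and> a $ i < p $ i) \<and>
     real_of_int k = (\<Sum>i\<in>UNIV. a $ i / p $ i) + (\<Prod>i\<in>UNIV. 1 / p $ i))"

lemma prod_coprime_dvd:
  fixes f :: "'a \<Rightarrow> int"
  assumes "finite A" "\<And>i. i \<in> A \<Longrightarrow> f i dvd x"
    "\<And>i j. i \<in> A \<Longrightarrow> j \<in> A \<Longrightarrow> i \<noteq> j \<Longrightarrow> coprime (f i) (f j)"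
  shows "prod f A dvd x"
  using assms
proof (induction A rule: finite_induct)
  case (insert i A)
  then have "coprime (f i) (prod f A)"
    by (intro prod_coprime_right) auto
  with insert show ?case by (simp add: divides_mult)
qed simp

lemma k_of_vector_ex1:
  fixes p :: "int ^ 'n"
  assumes gt1: "\<And>i. 1 < p $ i"
    and cop: "\<And>i j. i \<noteq> j \<Longrightarrow> coprime (p $ i) (p $ j)"
  shows "\<exists>!a. (\<forall>i. 0 \<le> a $ i \<and> a $ i < p $ i) \<and>
    (\<Sum>i\<in>UNIV. a $ i / p $ i) + (\<Prod>i\<in>UNIV. 1 / p $ i) \<in> (\<int> :: real set)"
proof -
  define K :: "int ^ 'n \<Rightarrow> real"
    where "K a = (\<Sum>i\<in>UNIV. a $ i / p $ i) + (\<Prod>i\<in>UNIV. 1 / p $ i)" for a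
  define P where "P = (\<Prod>i\<in>UNIV. p $ i)"
  define W where "W i = (\<Prod>j\<in>UNIV - {i}. p $ j)" for i
  have PW: "P = p $ i * W i" for i
    unfolding P_def W_def by (rule prod.remove) auto
  have Ppos: "P > 0" unfolding P_def using gt1 by (intro prod_pos) (meson less_trans zero_less_one)
  have nz: "p $ i \<noteq> 0" for i using gt1[of i] by simp
  have copW: "coprime (W i) (p $ i)" for i
    unfolding W_def by (rule prod_coprime_left) (use cop in auto)
  have dvdW: "p $ j dvd W i" if "i \<noteq> j" for i j
    unfolding W_def using that by (intro dvd_prodI) auto
  have split: "(\<Sum>i\<in>UNIV. a $ i * W i) = a $ j * W j + (\<Sum>i\<in>UNIV - {j}. a $ i * W i)"
    for a :: "int ^ 'n" and j
    by (rule sum.remove) auto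
  have rest: "p $ j dvd (\<Sum>i\<in>UNIV - {j}. a $ i * W i)" for a :: "int ^ 'n" and j
    by (intro dvd_sum dvd_mult) (use dvdW in auto)
  have key: "K a \<in> \<int> \<longleftrightarrow> (\<forall>j. p $ j dvd a $ j * W j + 1)" for a :: "int ^ 'n"
  proof -
    have 1: "of_int (a $ i) / of_int (p $ i) = (of_int (a $ i * W i) / of_int P :: real)" for i
      using PW[of i] Ppos nz[of i] by (auto simp: field_simps)
    have "K a = of_int ((\<Sum>i\<in>UNIV. a $ i * W i) + 1) / of_int P"
      unfolding K_def 1 by (simp add: P_def prod_dividef add_divide_distrib sum_divide_distrib)
    then have "K a \<in> \<int> \<longleftrightarrow> P dvd (\<Sum>i\<in>UNIV. a $ i * W i) + 1"
      using Ppos of_int_div_of_int_in_Ints_iff by (metis less_irrefl)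
    also have "\<dots> \<longleftrightarrow> (\<forall>j. p $ j dvd (\<Sum>i\<in>UNIV. a $ i * W i) + 1)"
    proof
      assume "P dvd (\<Sum>i\<in>UNIV. a $ i * W i) + 1"
      then show "\<forall>j. p $ j dvd (\<Sum>i\<in>UNIV. a $ i * W i) + 1"
        using PW by (metis dvd_mult_left)
    next
      assume "\<forall>j. p $ j dvd (\<Sum>i\<in>UNIV. a $ i * W i) + 1"
      then show "P dvd (\<Sum>i\<in>UNIV. a $ i * W i) + 1"
        unfolding P_def using cop by (intro prod_coprime_dvd) auto
    qed
    also have "\<dots> \<longleftrightarrow> (\<forall>j. p $ j dvd a $ j * W j + 1)"
    proof -
      have "p $ j dvd (\<Sum>i\<in>UNIV. a $ i * W i) + 1 \<longleftrightarrow> p $ j dvd a $ j * W j + 1" for j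
        using dvd_add_left_iff[OF rest[of j a], of "a $ j * W j + 1"] split[of a j]
        by (simp add: algebra_simps)
      then show ?thesis by simp
    qed
    finally show ?thesis .
  qed
  have "\<exists>x. 0 \<le> x \<and> x < p $ i \<and> p $ i dvd x * W i + 1" for i
  proof -
    obtain b c where bc: "b * W i + c * p $ i = 1"
      using copW[of i] bezout_int[of "W i" "p $ i"] by (metis coprime_imp_gcd_eq_1)
    have "p $ i dvd (- b mod p $ i - (- b)) * W i"
      by (rule dvd_mult2, rule iffD1[OF mod_eq_dvd_iff]) (rule mod_mod_trivial)
    moreover have "(- b mod p $ i) * W i + 1 = (- b mod p $ i - (- b)) * W i + c * p $ i"
      using bc by (simp add: algebra_simps)
    ultimately have "p $ i dvd (- b mod p $ i) * W i + 1" by simp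
    then show ?thesis using gt1[of i]
      by (intro exI[of _ "- b mod p $ i"]) simp
  qed
  then obtain f where f: "\<And>i. 0 \<le> f i \<and> f i < p $ i \<and> p $ i dvd f i * W i + 1" by metis
  show ?thesis
    unfolding K_def[symmetric]
  proof (rule ex1I)
    show "(\<forall>i. 0 \<le> (\<chi> i. f i) $ i \<and> (\<chi> i. f i) $ i < p $ i) \<and> K (\<chi> i. f i) \<in> \<int>"
      using f by (simp add: key)
  next
    fix a assume a: "(\<forall>i. 0 \<le> a $ i \<and> a $ i < p $ i) \<and> K a \<in> \<int>"
    have "a $ i = f i" for i
    proof -
      have "p $ i dvd (a $ i * W i + 1) - (f i * W i + 1)"
        using a f[of i] by (intro dvd_diff) (auto simp: key)
      then have "p $ i dvd (a $ i - f i) * W i" by (simp add: algebra_simps)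
      then have "p $ i dvd a $ i - f i"
        using copW[of i] by (simp add: coprime_dvd_mult_left_iff coprime_commute)
      then have "a $ i mod p $ i = f i mod p $ i" by (simp add: mod_eq_dvd_iff)
      then show ?thesis using a f[of i] by simp
    qed
    then show "a = (\<chi> i. f i)" by (simp add: vec_eq_iff)
  qed
qed

end

theory Submission
  imports Defs
begin

text \<open>
  Put \<open>P = \<Prod>i. p\<^sub>i\<close>, so that \<open>w\<^sub>i = P / p\<^sub>i\<close> and \<open>d\<^sub>w = P\<close>. Modulo \<open>p\<^sub>i\<close> only the \<open>i\<close>th summand
  of \<open>w \<cdot> v\<close> survives, so \<open>P\<close> divides \<open>w \<cdot> v\<close> iff every \<open>p\<^sub>i\<close> divides \<open>v\<^sub>i\<close>. Hence the bubbles are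
  the vectors \<open>u\<close> with \<open>0 \<le> u\<^sub>i < p\<^sub>i\<close> and \<open>w \<cdot> u \<ge> 2 P\<close>, which gives (b). If
  \<open>\<Sum>i. a\<^sub>i / p\<^sub>i + 1 / P = 1\<close>, then \<open>u = p - a\<close> is a bubble of degree \<open>(n - 1) P + 1\<close>.
  For any \<open>i\<close>, the vector in (a) has degree \<open>(n - 2) m P + 1\<close>, so in a decomposition into \<open>m\<close>
  elements of \<open>V\<^sup>+((n - 2) P)\<close> all summands but one have degree exactly \<open>(n - 2) P\<close>. Those equal
  \<open>(n - 2) p\<^sub>i e\<^sub>i\<close>, because their other entries are bounded by those of \<open>u\<close>. The remaining summand
  would be \<open>u - p\<^sub>i e\<^sub>i\<close>, which has a negative entry.
\<close>

lemma dot_add: "dot w (u + v) = dot w u + dot w v"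
  by (simp add: dot_def sum.distrib distrib_left)

lemma dot_diff: "dot w (u - v) = dot w u - dot w v"
  by (simp add: dot_def sum_subtractf right_diff_distrib)

lemma dot_sum: "dot w (sum f A) = (\<Sum>j\<in>A. dot w (f j))"
  by (simp add: dot_def sum_distrib_left sum.swap[of _ A])

lemma dot_axis: "dot w (c *s axis i 1) = c * w $ i"
proof -
  have "dot w (c *s axis i 1) = (\<Sum>j\<in>UNIV. if j = i then c * w $ i else 0)"
    unfolding dot_def by (intro sum.cong) (auto simp: axis_def)
  then show ?thesis by simp
qed

text \<open>Uniqueness of the vector in \<open>k_of_vector_ex1\<close> passes to the integer it
  determines, so the \<open>THE\<close> in \<open>k_of\<close> denotes an actual value.\<close>

lemma k_of_obtain:
  fixes p :: "int ^ 'n"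
  assumes "\<And>i. 1 < p $ i" "\<And>i j. i \<noteq> j \<Longrightarrow> coprime (p $ i) (p $ j)"
  obtains a where "\<And>i. 0 \<le> a $ i" "\<And>i. a $ i < p $ i"
    "real_of_int (k_of p) = (\<Sum>i\<in>UNIV. a $ i / p $ i) + (\<Prod>i\<in>UNIV. 1 / p $ i)"
proof -
  let ?K = "\<lambda>a :: int ^ 'n. (\<Sum>i\<in>UNIV. a $ i / p $ i) + (\<Prod>i\<in>UNIV. 1 / p $ i) :: real"
  let ?Q = "\<lambda>k a. (\<forall>i. 0 \<le> a $ i \<and> a $ i < p $ i) \<and> real_of_int k = ?K a"
  obtain a where a: "\<forall>i. 0 \<le> a $ i \<and> a $ i < p $ i" "?K a \<in> \<int>"
    and uniq: "\<And>b. (\<forall>i. 0 \<le> b $ i \<and> b $ i < p $ i) \<Longrightarrow> ?K b \<in> \<int> \<Longrightarrow> b = a"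
    using k_of_vector_ex1[OF assms] by blast
  from a(2) obtain k where k: "real_of_int k = ?K a" by (metis Ints_cases)
  have "\<exists>!k. \<exists>a. ?Q k a"
  proof (rule ex1I)
    show "\<exists>a. ?Q k a" using a(1) k by blast
  next
    fix k' assume "\<exists>a. ?Q k' a"
    then obtain b where b: "?Q k' b" by blast
    then have "b = a" by (intro uniq) (auto simp flip: b[THEN conjunct2])
    with b k show "k' = k" by (metis of_int_eq_iff)
  qed
  then have "\<exists>a. ?Q (k_of p) a" unfolding k_of_def by (rule theI')
  then show ?thesis using that by blast
qed

locale coprime_vector =
  fixes p :: "int ^ 'n"
  assumes ge2: "2 \<le> p $ i"
    and coprime: "i \<noteq> j \<Longrightarrow> coprime (p $ i) (p $ j)"
    and card_ge2: "2 \<le> CARD('n)"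
begin

definition P :: int where "P = (\<Prod>i\<in>UNIV. p $ i)"

definition w :: "int ^ 'n" where "w = (\<chi> i. P div p $ i)"

lemma p_pos: "0 < p $ i"
  using ge2[of i] by simp

lemma P_pos: "0 < P"
  unfolding P_def using p_pos by (intro prod_pos) auto

lemma w_eq: "w $ i = (\<Prod>j\<in>UNIV - {i}. p $ j)"
  using p_pos[of i] by (simp add: w_def P_def prod.remove[of UNIV i])

lemma p_times_w: "p $ i * w $ i = P"
  unfolding w_eq P_def by (rule prod.remove[symmetric]) auto

lemma w_pos: "0 < w $ i"
  unfolding w_eq using p_pos by (intro prod_pos) auto

lemma P_div_w: "c * P div w $ i = c * p $ i"
  using w_pos[of i] by (simp flip: p_times_w[of i] mult.assoc)

lemma coprime_p_w: "coprime (p $ i) (w $ i)"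
  unfolding w_eq by (rule prod_coprime_right) (use coprime in auto)

lemma p_dvd_w: "i \<noteq> j \<Longrightarrow> p $ j dvd w $ i"
  unfolding w_eq by (intro dvd_prodI) auto

lemma P_dvdI: "(\<And>i. p $ i dvd x) \<Longrightarrow> P dvd x"
  unfolding P_def using coprime by (intro prod_coprime_dvd) auto

lemma lcm_vec_w: "lcm_vec w = P"
proof (rule zdvd_antisym_nonneg)
  show "lcm_vec w dvd P"
    unfolding lcm_vec_def by (rule Lcm_least) (metis imageE dvd_triv_right p_times_w)
  show "P dvd lcm_vec w"
  proof (rule P_dvdI)
    fix i :: 'n
    \<comment> \<open>The factor \<open>p $ i\<close> is missing from \<open>w $ i\<close>, so it
      has to come from another entry of \<open>w\<close>. With a single index the lcm would be
      1.\<close>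
    have "UNIV \<noteq> {i}"
    proof
      assume "UNIV = {i}"
      then have "CARD('n) = card {i}" by (rule arg_cong)
      with card_ge2 show False by simp
    qed
    then obtain j where "j \<noteq> i" by auto
    then have "p $ i dvd w $ j" by (rule p_dvd_w)
    also have "w $ j dvd lcm_vec w" unfolding lcm_vec_def by (rule dvd_Lcm) auto
    finally show "p $ i dvd lcm_vec w" .
  qed
qed (use P_pos in \<open>auto simp: lcm_vec_def\<close>)

text \<open>Every \<open>w $ j\<close> with j \<noteq> i contains the factor \<open>p $ i\<close>.
  The shift \<open>c\<close> is 0 for divisibility of entries and 1 for the equation defining
  \<open>k_of\<close>.\<close>

lemma p_dvd_dot_iff: "p $ i dvd dot w v + c \<longleftrightarrow> p $ i dvd w $ i * v $ i + c"
proof -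
  have "dot w v = w $ i * v $ i + (\<Sum>j\<in>UNIV - {i}. w $ j * v $ j)"
    unfolding dot_def by (rule sum.remove) auto
  moreover have rest: "p $ i dvd (\<Sum>j\<in>UNIV - {i}. w $ j * v $ j)"
    by (intro dvd_sum dvd_mult2 p_dvd_w) auto
  ultimately show ?thesis
    using dvd_add_right_iff[OF rest, of "w $ i * v $ i + c"] by (simp add: algebra_simps)
qed

lemma p_dvd_entry:
  assumes "P dvd dot w v"
  shows "p $ i dvd v $ i"
proof -
  have "p $ i dvd P" unfolding P_def by (rule dvd_prodI) auto
  then have "p $ i dvd w $ i * v $ i" using assms p_dvd_dot_iff[of i v 0] by auto
  then show ?thesis using coprime_p_w[of i] by (simp add: coprime_dvd_mult_right_iff)
qed

lemma entry_eq_0: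
  assumes "P dvd dot w v" "0 \<le> v $ i" "v $ i < p $ i"
  shows "v $ i = 0"
  using p_dvd_entry[OF assms(1), of i] assms(2,3) zdvd_imp_le[of "p $ i" "v $ i"] by linarith

lemma dot_p: "dot w p = int CARD('n) * P"
  by (simp add: dot_def p_times_w mult.commute[of "w $ _"])

text \<open>A vector of degree \<open>P\<close> has its entries divisible by those of
  \<open>p\<close>, so below \<open>u\<close> with all \<open>u $ i < p $ i\<close> it would vanish.
  Conversely, \<open>p $ i *s axis i 1\<close> has degree \<open>P\<close> and fits below
  \<open>u\<close> once \<open>p $ i \<le> u $ i\<close>.\<close>

lemma bubble_iff: "bubble w u \<longleftrightarrow> (\<forall>i. 0 \<le> u $ i \<and> u $ i < p $ i) \<and> 2 * P \<le> dot w u"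
proof -
  have "(\<exists>v. 0 \<le> v \<and> dot w v = P \<and> v \<le> u) \<longleftrightarrow> (\<exists>i. p $ i \<le> u $ i)" if "0 \<le> u"
  proof
    assume "\<exists>v. 0 \<le> v \<and> dot w v = P \<and> v \<le> u"
    then obtain v where v: "\<And>i. 0 \<le> v $ i" "dot w v = P" "\<And>i. v $ i \<le> u $ i"
      by (auto simp: less_eq_vec_def)
    show "\<exists>i. p $ i \<le> u $ i"
    proof (rule ccontr)
      assume "\<not> ?thesis"
      then have "v $ i = 0" for i
        using v by (intro entry_eq_0) (auto simp: not_le intro: le_less_trans)
      then have "dot w v = 0" by (simp add: dot_def)
      with v P_pos show False by simp
    qed
  next
    assume "\<exists>i. p $ i \<le> u $ i"
    then obtain i where "p $ i \<le> u $ i" ..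
    then show "\<exists>v. 0 \<le> v \<and> dot w v = P \<and> v \<le> u"
      using that p_pos[of i]
      by (intro exI[of _ "p $ i *s axis i 1"])
        (simp add: dot_axis p_times_w, auto simp: less_eq_vec_def axis_def)
  qed
  then have "bubble w u \<longleftrightarrow> 0 \<le> u \<and> 2 * P \<le> dot w u \<and> (\<forall>i. u $ i < p $ i)"
    unfolding bubble_def lcm_vec_w by (metis not_le)
  then show ?thesis by (auto simp: less_eq_vec_def)
qed

lemma dot_bubble_less:
  assumes "bubble w u"
  shows "dot w u < int CARD('n) * P"
proof -
  have "dot w u < dot w p"
    unfolding dot_def using assms w_pos by (intro sum_strict_mono) (auto simp: bubble_iff)
  then show ?thesis by (simp add: dot_p)
qed

lemma k_of_eq_1_obtain:
  assumes "k_of p = 1"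
  obtains a where "\<And>i. 0 < a $ i" "\<And>i. a $ i < p $ i" "dot w a + 1 = P"
proof -
  obtain a where a: "\<And>i. 0 \<le> a $ i" "\<And>i. a $ i < p $ i"
    and 1: "1 = (\<Sum>i\<in>UNIV. real_of_int (a $ i) / p $ i) + (\<Prod>i\<in>UNIV. 1 / p $ i)"
  proof (rule k_of_obtain[of p])
    show "1 < p $ i" for i using ge2[of i] by simp
  qed (use coprime assms in auto)
  have "real_of_int (a $ i) / p $ i = of_int (w $ i * a $ i) / P" for i
    using p_pos[of i] w_pos[of i] unfolding p_times_w[of i, symmetric] by simp
  then have "1 = real_of_int (dot w a + 1) / P"
    using 1 by (simp add: dot_def prod_dividef P_def add_divide_distrib sum_divide_distrib)
  then have dot: "dot w a + 1 = P" using P_pos by (simp add: field_simps flip: of_int_add)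
  \<comment> \<open>If \<open>a $ i\<close> were 0, then \<open>p $ i\<close> would divide 1.
    Positivity keeps the entries of \<open>p - a\<close> strictly below those of
    \<open>p\<close>.\<close>
  moreover have "0 < a $ i" for i
  proof -
    have "p $ i dvd dot w a + 1" using dot p_times_w[of i] by (metis dvd_triv_left)
    then have "p $ i dvd w $ i * a $ i + 1" by (simp add: p_dvd_dot_iff)
    then have "a $ i \<noteq> 0" using ge2[of i] by auto
    with a(1)[of i] show ?thesis by simp
  qed
  ultimately show ?thesis using a(2) that by blast
qed

text \<open>Used with s = n - 2, where \<open>c\<close> is the coefficient s m - (n - 1) of the
  theorem.\<close>

lemma not_in_minkowski_multiple:
  assumes u: "\<And>j. u $ j < p $ j"
    and dot: "dot w u + c * P = s * int m * P + 1"
    and c: "c = s * (int m - 1) - 1"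
  shows "u + (c * p $ i) *s axis i 1 \<notin> minkowski_multiple m (Vplus w (s * P))"
proof
  let ?x = "u + (c * p $ i) *s axis i 1"
  assume "?x \<in> minkowski_multiple m (Vplus w (s * P))"
  then obtain f where x: "?x = (\<Sum>j<m. f j)" and f: "\<And>j. j < m \<Longrightarrow> f j \<in> Vplus w (s * P)"
    by (auto simp: minkowski_multiple_def set_sum_alt)
  have nonneg: "0 \<le> f j $ l" and ge: "s * P \<le> dot w (f j)" if "j < m" for j l
    using f[OF that] by (auto simp: Vplus_def less_eq_vec_def)
  \<comment> \<open>The excesses over the threshold are nonnegative integers with sum 1, so exactly
    one of them is nonzero.\<close>
  define g where "g j = dot w (f j) - s * P" for j
  have g0: "0 \<le> g j" if "j < m" for j using ge[OF that] by (simp add: g_def)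
  have "dot w ?x = s * int m * P + 1"
    using dot by (simp add: dot_add dot_axis p_times_w mult.assoc)
  then have sum_g: "(\<Sum>j<m. g j) = 1"
    unfolding x dot_sum by (simp add: g_def sum_subtractf)
  obtain k where k: "k < m" "g k \<noteq> 0"
    using sum_g by (metis lessThan_iff sum.neutral zero_neq_one)
  have "(\<Sum>j\<in>{..<m} - {k}. g j) = 1 - g k"
    using sum_g k(1) by (simp add: sum.remove[of _ k])
  then have "(\<Sum>j\<in>{..<m} - {k}. g j) = 0"
    using k g0[of k] sum_nonneg[of "{..<m} - {k}" g] g0 by fastforce
  then have g_eq: "g j = 0" if "j < m" "j \<noteq> k" for j
    using that g0 by (subst (asm) sum_nonneg_eq_0_iff) auto
  have fi: "f j $ i = s * p $ i" if j: "j < m" "j \<noteq> k" for j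
  proof -
    have dj: "dot w (f j) = s * P" using g_eq[OF j] by (simp add: g_def)
    \<comment> \<open>Away from \<open>i\<close> the sum \<open>?x\<close> agrees with
      \<open>u\<close>, so the entry lies below \<open>p $ l\<close>, which also divides it.\<close>
    have "f j $ l = 0" if "l \<noteq> i" for l
    proof (rule entry_eq_0)
      have "f j $ l \<le> (\<Sum>j<m. f j $ l)" using j nonneg by (intro member_le_sum) auto
      also have "\<dots> = ?x $ l" unfolding x by simp
      also have "\<dots> = u $ l" using that by (simp add: axis_def)
      finally show "f j $ l < p $ l" using u[of l] by simp
    qed (use dj nonneg j in auto)
    then have "dot w (f j) = w $ i * f j $ i"
      by (subst dot_def, subst sum.remove[of _ i]) auto
    with dj have "w $ i * f j $ i = w $ i * (s * p $ i)" by (simp flip: p_times_w[of i])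
    then show ?thesis using w_pos[of i] by simp
  qed
  have "u $ i + c * p $ i = (\<Sum>j<m. f j) $ i" unfolding x[symmetric] by (simp add: axis_def)
  also have "\<dots> = f k $ i + (\<Sum>j\<in>{..<m} - {k}. f j $ i)"
    using k(1) by (simp add: sum.remove)
  also have "(\<Sum>j\<in>{..<m} - {k}. f j $ i) = (int m - 1) * (s * p $ i)"
    using fi k(1) by (simp add: of_nat_diff)
  \<comment> \<open>The other m - 1 summands use up s (m - 1) of the coefficient \<open>c\<close>;
    what remains is its -1.\<close>
  finally have "u $ i - p $ i = f k $ i" by (simp add: c algebra_simps)
  with nonneg[OF k(1), of i] u[of i] show False by simp
qed

end

theorem theorem8p8:
  fixes p w :: "int ^ 'n"
  assumes "3 \<le> CARD('n)"
    and "\<forall>i. 2 \<le> p $ i"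
    and "\<forall>i j. i \<noteq> j \<longrightarrow> coprime (p $ i) (p $ j)"
    and "k_of p = 1"
    and "w = (\<chi> i. (\<Prod>j\<in>UNIV. p $ j) div p $ i)"
  shows
    "(\<exists>u. bubble w u \<and> dot w u = (int CARD('n) - 1) * lcm_vec w + 1 \<and>
       (\<exists>i. \<forall>m::nat. 0 < m \<longrightarrow>
          u + ((((int CARD('n) - 2) * int m - dot w u div lcm_vec w) * lcm_vec w) div w $ i) *s axis i 1
            \<notin> minkowski_multiple m (Vplus w ((int CARD('n) - 2) * lcm_vec w)))) \<and>
     (\<forall>u'. bubble w u' \<longrightarrow> dot w u' < int CARD('n) * lcm_vec w)"
proof -
  interpret cv: coprime_vector p using assms by unfold_locales auto
  have w: "w = cv.w" by (simp add: assms(5) cv.w_def cv.P_def)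
  let ?n = "int CARD('n)" and ?P = "cv.P"
  obtain a where a: "\<And>i. 0 < a $ i" "\<And>i. a $ i < p $ i" and dot_a: "dot w a + 1 = ?P"
    using cv.k_of_eq_1_obtain assms(4) w by blast
  define u where "u = p - a"
  have u_less: "u $ i < p $ i" for i using a by (simp add: u_def)
  have dot_u: "dot w u = (?n - 1) * ?P + 1"
    using dot_a by (simp add: u_def dot_diff w cv.dot_p algebra_simps)
  have "2 * ?P \<le> (?n - 1) * ?P" using assms(1) cv.P_pos by (intro mult_right_mono) auto
  then have "bubble w u"
    using a u_less dot_u by (simp add: w cv.bubble_iff) (simp add: u_def less_imp_le)
  moreover have "u + (((?n - 2) * int m - dot w u div ?P) * ?P div w $ i) *s axis i 1
      \<notin> minkowski_multiple m (Vplus w ((?n - 2) * ?P))" for m i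
  proof -
    \<comment> \<open>The quotient of (n - 1) P + 1 by P is n - 1 because P > 1, so that the
      remainder 1 does not carry.\<close>
    have "p $ i * 1 \<le> p $ i * cv.w $ i"
      using cv.p_pos[of i] cv.w_pos[of i] by (intro mult_left_mono) auto
    then have "1 < ?P" using cv.ge2[of i] cv.p_times_w[of i] by simp
    then have div: "dot w u div ?P = ?n - 1" unfolding dot_u by simp
    show ?thesis unfolding div unfolding w cv.P_div_w
      by (rule cv.not_in_minkowski_multiple[OF u_less])
        (use dot_u in \<open>auto simp: w algebra_simps\<close>)
  qed
  ultimately show ?thesis
    using dot_u cv.dot_bubble_less by (auto simp: w cv.lcm_vec_w)
qed

end
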